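(* Let $\mathcal{W}$ be a Kripke model and $W$ a world of $\mathcal{W}$, and suppose that $W$ admits arbitrarily large finite families of independent switches. Then every propositional modal formula that is valid at $W$ (with respect to substitution instances by assertions from a class containing these switches and closed under finite Boolean combinations) belongs to the modal theory S5.
   Context: A statement $s$ is a switch at a world $W$ of a Kripke model if both $\Diamond s$ and $\Diamond\neg s$ hold at every world reachable from $W$ (by successive applications of the accessibility relation). A family of switches $s_0,s_1,\dots$ is independent if from any such world one can access a world realizing any desired finite pattern of truth values for finitely many of the switches. A propositional modal formula $\varphi(p_0,\dots,p_n)$ is valid at $W$ for a class of assertions if every substitution instance $\varphi(\psi_0,\dots,\psi_n)$ with $\psi_i$ from the class is true at $W$ (modal operators interpreted by the Kripke accessibility relation). *)

theory Defs
  imports Main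
begin

datatype (vars: 'v) mfm =
    Var 'v
  | Neg "'v mfm"
  | Conj "'v mfm" "'v mfm"
  | Box "'v mfm"

definition Imp :: "'v mfm \<Rightarrow> 'v mfm \<Rightarrow> 'v mfm" where
  "Imp \<phi> \<psi> = Neg (Conj \<phi> (Neg \<psi>))"

definition Dia :: "'v mfm \<Rightarrow> 'v mfm" where
  "Dia \<phi> = Neg (Box (Neg \<phi>))"

text \<open>Propositional evaluation: variables and boxed formulas are treated as atoms, so that
  tautologies are exactly the substitution instances of classical propositional tautologies.\<close>

primrec peval :: "('v mfm \<Rightarrow> bool) \<Rightarrow> 'v mfm \<Rightarrow> bool" where
  "peval v (Var i) \<longleftrightarrow> v (Var i)"
| "peval v (Neg \<phi>) \<longleftrightarrow> \<not> peval v \<phi>"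
| "peval v (Conj \<phi> \<psi>) \<longleftrightarrow> peval v \<phi> \<and> peval v \<psi>"
| "peval v (Box \<phi>) \<longleftrightarrow> v (Box \<phi>)"

definition tautology :: "'v mfm \<Rightarrow> bool" where
  "tautology \<phi> \<longleftrightarrow> (\<forall>v. peval v \<phi>)"

inductive_set S5 :: "'v mfm set" where
  taut: "tautology \<phi> \<Longrightarrow> \<phi> \<in> S5"
| K: "Imp (Box (Imp \<phi> \<psi>)) (Imp (Box \<phi>) (Box \<psi>)) \<in> S5"
| T: "Imp (Box \<phi>) \<phi> \<in> S5"
| four: "Imp (Box \<phi>) (Box (Box \<phi>)) \<in> S5"
| five: "Imp (Dia \<phi>) (Box (Dia \<phi>)) \<in> S5"
| MP: "\<phi> \<in> S5 \<Longrightarrow> Imp \<phi> \<psi> \<in> S5 \<Longrightarrow> \<psi> \<in> S5"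
| Nec: "\<phi> \<in> S5 \<Longrightarrow> Box \<phi> \<in> S5"

text \<open>The assertions interpreted at the worlds form an arbitrary type \<^typ>\<open>'s\<close> with Boolean
  connectives and a necessity operator (propositional modal formulas over some valuation,
  sentences of a first-order modal language, \<dots>). Nothing is assumed about the accessibility
  relation.\<close>

record ('w, 's) kripke =
  worlds :: "'w set"
  acc :: "('w \<times> 'w) set"
  holds :: "'w \<Rightarrow> 's \<Rightarrow> bool"
  neg :: "'s \<Rightarrow> 's"
  con :: "'s \<Rightarrow> 's \<Rightarrow> 's"
  nec :: "'s \<Rightarrow> 's"

definition kripke_model :: "('w, 's) kripke \<Rightarrow> bool" where
  "kripke_model M \<longleftrightarrow>
     acc M \<subseteq> worlds M \<times> worlds M \<and>
     (\<forall>u\<in>worlds M. \<forall>a. holds M u (neg M a) \<longleftrightarrow> \<not> holds M u a) \<and>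
     (\<forall>u\<in>worlds M. \<forall>a b. holds M u (con M a b) \<longleftrightarrow> holds M u a \<and> holds M u b) \<and>
     (\<forall>u\<in>worlds M. \<forall>a. holds M u (nec M a) \<longleftrightarrow> (\<forall>v. (u, v) \<in> acc M \<longrightarrow> holds M v a))"

definition poss :: "('w, 's) kripke \<Rightarrow> 's \<Rightarrow> 's" where
  "poss M a = neg M (nec M (neg M a))"

lemma holds_poss:
  assumes "kripke_model M" "u \<in> worlds M"
  shows "holds M u (poss M a) \<longleftrightarrow> (\<exists>v. (u, v) \<in> acc M \<and> holds M v a)"
  using assms unfolding kripke_model_def poss_def by blast

text \<open>Zero steps are allowed: \<^term>\<open>w\<close> counts as reachable from itself even if the accessibility
  relation is not reflexive.\<close>

definition reachable :: "('w, 's) kripke \<Rightarrow> 'w \<Rightarrow> 'w set" where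
  "reachable M w = {u. (w, u) \<in> (acc M)\<^sup>*}"

definition switch :: "('w, 's) kripke \<Rightarrow> 'w \<Rightarrow> 's \<Rightarrow> bool" where
  "switch M w s \<longleftrightarrow>
     (\<forall>u\<in>reachable M w. holds M u (poss M s) \<and> holds M u (poss M (neg M s)))"

definition independent_switches ::
    "('w, 's) kripke \<Rightarrow> 'w \<Rightarrow> 'i set \<Rightarrow> ('i \<Rightarrow> 's) \<Rightarrow> bool" where
  "independent_switches M w I s \<longleftrightarrow>
     (\<forall>i\<in>I. switch M w (s i)) \<and>
     (\<forall>u\<in>reachable M w. \<forall>F p. F \<subseteq> I \<and> finite F \<longrightarrow>
        (\<exists>v. (u, v) \<in> acc M \<and> (\<forall>i\<in>F. holds M v (s i) \<longleftrightarrow> p i)))"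

definition arbitrarily_large_independent_switches ::
    "('w, 's) kripke \<Rightarrow> 'w \<Rightarrow> 's set \<Rightarrow> bool" where
  "arbitrarily_large_independent_switches M w C \<longleftrightarrow>
     (\<forall>n. \<exists>(I :: nat set) s. finite I \<and> n \<le> card I \<and> s ` I \<subseteq> C \<and> independent_switches M w I s)"

definition boolean_closed :: "('w, 's) kripke \<Rightarrow> 's set \<Rightarrow> bool" where
  "boolean_closed M C \<longleftrightarrow>
     (\<forall>a\<in>C. neg M a \<in> C) \<and> (\<forall>a\<in>C. \<forall>b\<in>C. con M a b \<in> C)"

primrec inst :: "('w, 's) kripke \<Rightarrow> ('v \<Rightarrow> 's) \<Rightarrow> 'v mfm \<Rightarrow> 's" where
  "inst M \<sigma> (Var i) = \<sigma> i"
| "inst M \<sigma> (Neg \<phi>) = neg M (inst M \<sigma> \<phi>)"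
| "inst M \<sigma> (Conj \<phi> \<psi>) = con M (inst M \<sigma> \<phi>) (inst M \<sigma> \<psi>)"
| "inst M \<sigma> (Box \<phi>) = nec M (inst M \<sigma> \<phi>)"

definition valid_at :: "('w, 's) kripke \<Rightarrow> 'w \<Rightarrow> 's set \<Rightarrow> 'v mfm \<Rightarrow> bool" where
  "valid_at M w C \<phi> \<longleftrightarrow> (\<forall>\<sigma>. \<sigma> ` vars \<phi> \<subseteq> C \<longrightarrow> holds M w (inst M \<sigma> \<phi>))"

end

theory Submission
  imports Defs
begin

text \<open>If \<open>\<phi>\<close> is not in S5, a canonical-model argument refutes it at a point \<open>v\<close> of a universal
  model \<open>U\<close> whose worlds are sets of variables of \<open>\<phi>\<close>, so \<open>U\<close> is finite. Given enough
  independent switches, label every switch pattern by an element of \<open>U\<close>, surjectively and so that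
  the pattern of \<open>W\<close> is labelled \<open>v\<close>. Every reachable world accesses all patterns, hence all of
  \<open>U\<close>; interpreting each variable \<open>p\<close> by the Boolean combination of switches saying
  ``\<open>p\<close> belongs to the label'' makes truth at a reachable world agree with truth in \<open>U\<close> at its
  label, so the instance of \<open>\<phi>\<close> fails at \<open>W\<close>.\<close>

primrec sat :: "'v set set \<Rightarrow> 'v set \<Rightarrow> 'v mfm \<Rightarrow> bool" where
  "sat U v (Var i) \<longleftrightarrow> i \<in> v"
| "sat U v (Neg \<phi>) \<longleftrightarrow> \<not> sat U v \<phi>"
| "sat U v (Conj \<phi> \<psi>) \<longleftrightarrow> sat U v \<phi> \<and> sat U v \<psi>"
| "sat U v (Box \<phi>) \<longleftrightarrow> (\<forall>u\<in>U. sat U u \<phi>)"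

text \<open>Closure under necessitation is deliberately not required: these are local theories.\<close>

definition S5_theory :: "'v mfm set \<Rightarrow> bool" where
  "S5_theory T \<longleftrightarrow> S5 \<subseteq> T \<and> (\<forall>a b. a \<in> T \<longrightarrow> Imp a b \<in> T \<longrightarrow> b \<in> T)"

definition complete_theory :: "'v mfm set \<Rightarrow> bool" where
  "complete_theory T \<longleftrightarrow> S5_theory T \<and> (\<forall>a. Neg a \<in> T \<longleftrightarrow> a \<notin> T)"

definition boxed :: "'v mfm set \<Rightarrow> 'v mfm set" where
  "boxed T = {a. Box a \<in> T}"

section \<open>Deduction inside local S5 theories\<close>

lemma peval_Imp [simp]: "peval v (Imp a b) \<longleftrightarrow> (peval v a \<longrightarrow> peval v b)"
  by (simp add: Imp_def)

lemma S5_theoryD: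
  assumes "S5_theory T"
  shows "a \<in> S5 \<Longrightarrow> a \<in> T" and "a \<in> T \<Longrightarrow> Imp a b \<in> T \<Longrightarrow> b \<in> T"
  using assms unfolding S5_theory_def by blast+

lemma S5_theory_MP_S5:
  assumes "S5_theory T" "a \<in> T" "Imp a b \<in> S5"
  shows "b \<in> T"
  using S5_theoryD(2)[OF assms(1,2) S5_theoryD(1)[OF assms(1,3)]] .

lemma S5_theory_consequence:
  assumes "S5_theory T" "a \<in> T" "\<And>v. peval v a \<Longrightarrow> peval v b"
  shows "b \<in> T"
  by (rule S5_theory_MP_S5[OF assms(1,2)], rule S5.taut) (simp add: tautology_def assms(3))

lemma S5_theory_consequence2:
  assumes "S5_theory T" "a \<in> T" "b \<in> T" "\<And>v. peval v a \<Longrightarrow> peval v b \<Longrightarrow> peval v c"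
  shows "c \<in> T"
proof -
  have "Imp b c \<in> T"
    using assms(1,2) by (rule S5_theory_consequence) (use assms(4) in auto)
  then show ?thesis
    by (rule S5_theoryD(2)[OF assms(1,3)])
qed

lemma S5_theory_S5: "S5_theory S5"
  unfolding S5_theory_def by (blast intro: S5.MP)

text \<open>This is the least theory containing \<open>T\<close> and \<open>a\<close>, described
  without derivations: the deduction theorem is built into its definition.\<close>

lemma S5_theory_adjoin:
  assumes "S5_theory T"
  shows "S5_theory {b. Imp a b \<in> T}"
  unfolding S5_theory_def
proof (intro conjI allI impI subsetI CollectI; (elim CollectE)?)
  fix b :: "'a mfm" assume "b \<in> S5"
  then have "b \<in> T"
    by (rule S5_theoryD(1)[OF assms])
  with assms show "Imp a b \<in> T"
    by (rule S5_theory_consequence) simp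
next
  fix b c assume "Imp a b \<in> T" "Imp a (Imp b c) \<in> T"
  then show "Imp a c \<in> T"
    by (rule S5_theory_consequence2[OF assms]) simp
qed

text \<open>Necessitation is applied only to members of \<open>S5\<close>, never to those of
  \<open>T\<close>; axiom K gives closure under modus ponens.\<close>

lemma S5_theory_boxed:
  assumes "S5_theory T"
  shows "S5_theory (boxed T)"
  unfolding S5_theory_def boxed_def
proof (intro conjI allI impI subsetI CollectI; (elim CollectE)?)
  fix b :: "'a mfm" assume "b \<in> S5"
  then show "Box b \<in> T"
    by (intro S5_theoryD(1)[OF assms] S5.Nec)
next
  fix b c assume "Box b \<in> T" "Box (Imp b c) \<in> T"
  then show "Box c \<in> T"
    using S5_theory_MP_S5[OF assms _ S5.K] S5_theoryD(2)[OF assms] by blast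
qed

section \<open>Lindenbaum's lemma and canonical-model completeness\<close>

text \<open>Zorn's lemma yields a theory maximal among those that omit \<open>\<phi>\<close>.
  Omitting \<open>\<phi>\<close> serves as consistency, and maximality makes the theory decide every
  formula.\<close>

lemma complete_theory_extends:
  assumes "S5_theory T" "\<phi> \<notin> T"
  obtains T' where "complete_theory T'" "T \<subseteq> T'" "\<phi> \<notin> T'"
proof -
  define \<A> where "\<A> = {T'. S5_theory T' \<and> T \<subseteq> T' \<and> \<phi> \<notin> T'}"
  have "\<exists>M\<in>\<A>. \<forall>X\<in>\<A>. M \<subseteq> X \<longrightarrow> X = M"
  proof (rule subset_Zorn_nonempty)
    show "\<A> \<noteq> {}"
      using assms by (auto simp: \<A>_def)
  next
    fix \<C> assume ne: "\<C> \<noteq> {}" and chain: "subset.chain \<A> \<C>"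
    then have sub: "\<C> \<subseteq> \<A>" and total: "\<And>X Y. X \<in> \<C> \<Longrightarrow> Y \<in> \<C> \<Longrightarrow> X \<subseteq> Y \<or> Y \<subseteq> X"
      by (auto simp: subset_chain_def)
    have "b \<in> \<Union>\<C>" if "a \<in> \<Union>\<C>" "Imp a b \<in> \<Union>\<C>" for a b
    proof -
      from that obtain X Y where "a \<in> X" "X \<in> \<C>" "Imp a b \<in> Y" "Y \<in> \<C>"
        by blast
      then obtain Z where "Z \<in> \<C>" "a \<in> Z" "Imp a b \<in> Z"
        using total by blast
      then show ?thesis
        using sub S5_theoryD(2) unfolding \<A>_def by blast
    qed
    moreover have "S5 \<subseteq> \<Union>\<C>" "T \<subseteq> \<Union>\<C>" "\<phi> \<notin> \<Union>\<C>"
      using ne sub unfolding \<A>_def S5_theory_def by blast+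
    ultimately show "\<Union>\<C> \<in> \<A>"
      unfolding \<A>_def S5_theory_def by blast
  qed
  then obtain M where "M \<in> \<A>" and maximal: "\<forall>X\<in>\<A>. M \<subseteq> X \<longrightarrow> X = M"
    by (rule bexE)
  from \<open>M \<in> \<A>\<close> have M: "S5_theory M" "T \<subseteq> M" "\<phi> \<notin> M"
    by (simp_all add: \<A>_def)
  have max: "X = M" if "S5_theory X" "M \<subseteq> X" "\<phi> \<notin> X" for X
    using maximal that M(2) by (simp add: \<A>_def)
  \<comment> \<open>Otherwise adjoining \<open>a\<close> would still omit \<open>\<phi>\<close>, so
    by maximality \<open>a\<close> would already lie in \<open>M\<close>.\<close>
  have refutes: "Imp a \<phi> \<in> M" if "a \<notin> M" for a
  proof (rule ccontr)
    assume "Imp a \<phi> \<notin> M"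
    moreover have "M \<subseteq> {b. Imp a b \<in> M}"
      by (rule subsetI, rule CollectI, erule S5_theory_consequence[OF M(1)]) simp
    ultimately have "{b. Imp a b \<in> M} = M"
      using max S5_theory_adjoin[OF M(1)] by blast
    moreover have "Imp a a \<in> M"
      by (rule S5_theoryD(1)[OF M(1)]) (auto intro: S5.taut simp: tautology_def)
    ultimately show False
      using that by blast
  qed
  have "Neg a \<in> M \<longleftrightarrow> a \<notin> M" for a
  proof
    show "a \<notin> M" if "Neg a \<in> M"
    proof
      assume "a \<in> M"
      with M(1) that have "\<phi> \<in> M"
        by (rule S5_theory_consequence2) simp
      with M(3) show False ..
    qed
    show "Neg a \<in> M" if "a \<notin> M"
    proof (rule ccontr)
      assume "Neg a \<notin> M"
      \<comment> \<open>Both \<open>a\<close> and \<open>Neg a\<close> imply \<open>\<phi>\<close>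
        in \<open>M\<close>, so a classical case split puts \<open>\<phi>\<close> in
        \<open>M\<close>.\<close>
      from M(1) refutes[OF this] refutes[OF that] have "\<phi> \<in> M"
        by (rule S5_theory_consequence2) auto
      with M(3) show False ..
    qed
  qed
  then have "complete_theory M"
    using M(1) by (simp add: complete_theory_def)
  then show ?thesis
    using M(2,3) by (rule that)
qed

lemma complete_theory_Conj:
  assumes "complete_theory T"
  shows "Conj a b \<in> T \<longleftrightarrow> a \<in> T \<and> b \<in> T"
proof -
  have T: "S5_theory T"
    using assms by (simp add: complete_theory_def)
  show ?thesis
    using S5_theory_consequence[OF T, of "Conj a b" a] S5_theory_consequence[OF T, of "Conj a b" b]
      S5_theory_consequence2[OF T, of a b "Conj a b"] by auto
qed

text \<open>In S5 the canonical relation is an equivalence: one-sided inclusion of the boxed part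
  already forces equality.\<close>

lemma boxed_eq_if_boxed_subset:
  assumes "complete_theory T" "complete_theory T'" "boxed T \<subseteq> T'"
  shows "boxed T' = boxed T"
proof -
  have T: "S5_theory T" and T': "S5_theory T'"
    and Neg: "\<And>a. Neg a \<in> T \<longleftrightarrow> a \<notin> T" "\<And>a. Neg a \<in> T' \<longleftrightarrow> a \<notin> T'"
    using assms by (auto simp: complete_theory_def)
  have transfer: "b \<in> T'" if "Box b \<in> T" for b
    using that assms(3) by (auto simp: boxed_def)
  \<comment> \<open>\<open>Dia (Neg b)\<close> unfolds to the negation of
    \<open>Box (Neg (Neg b))\<close>; this removes the double negation under the box.\<close>
  have dneg: "Box (Neg (Neg b)) \<in> X \<longleftrightarrow> Box b \<in> X" if "S5_theory X" for b :: "'a mfm" and X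
    using S5_theory_consequence[OF S5_theory_boxed[OF that], of b "Neg (Neg b)"]
      S5_theory_consequence[OF S5_theory_boxed[OF that], of "Neg (Neg b)" b]
    by (auto simp: boxed_def)
  have "Box b \<in> T' \<longleftrightarrow> Box b \<in> T" for b
  proof
    assume "Box b \<in> T"
    then show "Box b \<in> T'"
      using S5_theory_MP_S5[OF T _ S5.four] transfer by blast
  next
    assume "Box b \<in> T'"
    show "Box b \<in> T"
    proof (rule ccontr)
      assume "Box b \<notin> T"
      then have "Dia (Neg b) \<in> T"
        by (simp add: Dia_def Neg dneg[OF T])
      then have "Dia (Neg b) \<in> T'"
        using S5_theory_MP_S5[OF T _ S5.five] transfer by blast
      then show False
        using \<open>Box b \<in> T'\<close> by (simp add: Dia_def Neg dneg[OF T'])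
    qed
  qed
  then show ?thesis
    by (auto simp: boxed_def)
qed

text \<open>One equivalence class of the canonical model suffices. Each theory is collapsed to its
  variables among those of \<open>\<phi>\<close>; by the truth lemma, theories with the same trace
  agree on all formulas over these variables.\<close>

lemma S5_complete:
  assumes "\<phi> \<notin> S5"
  obtains U v where "U \<subseteq> Pow (vars \<phi>)" "v \<in> U" "\<not> sat U v \<phi>"
proof -
  obtain T0 where T0: "complete_theory T0" "\<phi> \<notin> T0"
    using complete_theory_extends[OF S5_theory_S5 assms] by metis
  define W where "W = {T. complete_theory T \<and> boxed T = boxed T0}"
  define val where "val T = {i \<in> vars \<phi>. Var i \<in> T}" for T
  have truth: "sat (val ` W) (val T) a \<longleftrightarrow> a \<in> T" if "vars a \<subseteq> vars \<phi>" "T \<in> W" for a T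
    using that
  proof (induction a arbitrary: T)
    case (Var i)
    then show ?case by (auto simp: val_def)
  next
    case (Neg a)
    then show ?case by (auto simp: W_def complete_theory_def)
  next
    case (Conj a b)
    then show ?case by (auto simp: W_def complete_theory_Conj)
  next
    case (Box a)
    have IH: "sat (val ` W) (val T') a \<longleftrightarrow> a \<in> T'" if "T' \<in> W" for T'
      using Box that by auto
    have T: "complete_theory T" "boxed T = boxed T0"
      using Box.prems by (auto simp: W_def)
    have "Box a \<in> T \<longleftrightarrow> (\<forall>T'\<in>W. a \<in> T')"
    proof
      assume "Box a \<in> T"
      show "\<forall>T'\<in>W. a \<in> T'"
      proof
        fix T' assume "T' \<in> W"
        then have "S5_theory T'" "Box a \<in> T'"
          using T(2) \<open>Box a \<in> T\<close> by (auto simp: W_def complete_theory_def boxed_def)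
        then show "a \<in> T'"
          by (rule S5_theory_MP_S5) (rule S5.T)
      qed
    next
      assume all: "\<forall>T'\<in>W. a \<in> T'"
      show "Box a \<in> T"
      proof (rule ccontr)
        assume "Box a \<notin> T"
        moreover have "S5_theory (boxed T)"
          using T(1) S5_theory_boxed by (auto simp: complete_theory_def)
        \<comment> \<open>Any complete extension of \<open>boxed T\<close> that omits
          \<open>a\<close> lies in \<open>W\<close>, because inclusion of the boxed part forces
          equality.\<close>
        ultimately obtain T' where "complete_theory T'" "boxed T \<subseteq> T'" "a \<notin> T'"
          using complete_theory_extends[of "boxed T" a] by (auto simp: boxed_def)
        then show False
          using all boxed_eq_if_boxed_subset[OF T(1)] T(2) by (auto simp: W_def)
      qed
    qed
    then show ?case
      using IH by auto
  qed
  have "T0 \<in> W"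
    using T0 by (simp add: W_def)
  then show ?thesis
    using that[of "val ` W" "val T0"] truth[of \<phi> T0] T0(2) by (auto simp: val_def)
qed

section \<open>Boolean combinations of switches and surjective labellings\<close>

text \<open>Any property of switch patterns is expressible by branching on one switch at a time.
  Nonemptiness of \<open>C\<close> supplies the constants true and false at the leaves.\<close>

lemma boolean_combination_exists:
  assumes M: "kripke_model M" and C: "boolean_closed M C" "C \<noteq> {}"
    and "finite I" "s ` I \<subseteq> C"
  shows "\<exists>a\<in>C. \<forall>u\<in>worlds M. holds M u a \<longleftrightarrow> Q {i \<in> I. holds M u (s i)}"
  using assms(4,5)
proof (induction I arbitrary: Q)
  case empty
  obtain c where "c \<in> C"
    using C by blast
  then have "con M c (neg M c) \<in> C" "neg M (con M c (neg M c)) \<in> C"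
    using C(1) by (auto simp: boolean_closed_def)
  moreover have "\<forall>u\<in>worlds M. \<not> holds M u (con M c (neg M c)) \<and>
      holds M u (neg M (con M c (neg M c)))"
    using M by (auto simp: kripke_model_def)
  ultimately show ?case
    by (cases "Q {}") auto
next
  case (insert i I)
  have sC: "s i \<in> C" "s ` I \<subseteq> C"
    using insert.prems by auto
  obtain a where a: "a \<in> C"
      "\<And>u. u \<in> worlds M \<Longrightarrow> holds M u a \<longleftrightarrow> Q (insert i {j \<in> I. holds M u (s j)})"
    using insert.IH[OF sC(2), of "\<lambda>P. Q (insert i P)"] by auto
  obtain b where b: "b \<in> C"
      "\<And>u. u \<in> worlds M \<Longrightarrow> holds M u b \<longleftrightarrow> Q {j \<in> I. holds M u (s j)}"
    using insert.IH[OF sC(2), of Q] by auto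
  \<comment> \<open>The conditional "if \<open>s i\<close> then \<open>a\<close> else
    \<open>b\<close>", written as a conjunction of two implications.\<close>
  define c where
    "c = con M (neg M (con M (s i) (neg M a))) (neg M (con M (neg M (s i)) (neg M b)))"
  have "c \<in> C"
    using C(1) sC(1) a(1) b(1) by (simp add: boolean_closed_def c_def)
  moreover have "holds M u c \<longleftrightarrow> Q {j \<in> insert i I. holds M u (s j)}" if "u \<in> worlds M" for u
  proof -
    have "{j \<in> insert i I. holds M u (s j)} =
        (if holds M u (s i) then insert i {j \<in> I. holds M u (s j)} else {j \<in> I. holds M u (s j)})"
      by auto
    moreover have "holds M u c \<longleftrightarrow> (if holds M u (s i) then holds M u a else holds M u b)"
      using M that by (auto simp: kripke_model_def c_def)
    ultimately show ?thesis
      using a(2)[OF that] b(2)[OF that] by auto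
  qed
  ultimately show ?case by blast
qed

lemma surjection_with_prescribed_value:
  assumes "finite A" "finite B" "card B \<le> card A" "a \<in> A" "b \<in> B"
  obtains f where "f ` A = B" "f a = b"
proof -
  have "card (B - {b}) \<le> card (A - {a})"
    using assms by simp
  then obtain g where g: "g ` (B - {b}) \<subseteq> A - {a}" "inj_on g (B - {b})"
    using assms card_le_inj[of "B - {b}" "A - {a}"] by auto
  \<comment> \<open>Since \<open>g\<close> avoids \<open>a\<close>, the default value
    \<open>b\<close> also gives \<open>f a = b\<close>.\<close>
  define f where "f x = (if x \<in> g ` (B - {b}) then inv_into (B - {b}) g x else b)" for x
  have "f a = b"
    using g(1) by (auto simp: f_def)
  moreover have "f x \<in> B" for x
    using assms(5) inv_into_into[of x g "B - {b}"] by (auto simp: f_def)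
  moreover have "y \<in> f ` A" if "y \<in> B" for y
  proof (cases "y = b")
    case True
    then show ?thesis using \<open>f a = b\<close> assms(4) by auto
  next
    case False
    then have "f (g y) = y" "g y \<in> A"
      using that g by (auto simp: f_def)
    then show ?thesis by (metis imageI)
  qed
  ultimately show ?thesis
    using that by blast
qed

section \<open>Transfer of truth along a labelling\<close>

lemma reachable_in_worlds:
  assumes "kripke_model M" "w \<in> worlds M" "u \<in> reachable M w"
  shows "u \<in> worlds M"
  using assms(3) unfolding reachable_def mem_Collect_eq
  by (induction rule: rtrancl_induct) (use assms(1,2) in \<open>auto simp: kripke_model_def\<close>)

text \<open>A labelling \<open>L\<close> of the reachable worlds that is as in this lemma is a bisimulation onto the
  universal model, except that \<open>w\<close> need not be accessible from any world.\<close>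

lemma holds_inst_iff_sat_label:
  assumes M: "kripke_model M" and w: "w \<in> worlds M"
    and \<sigma>: "\<And>u i. u \<in> worlds M \<Longrightarrow> holds M u (\<sigma> i) \<longleftrightarrow> i \<in> L u"
    and L: "\<And>u. u \<in> reachable M w \<Longrightarrow> L ` {v. (u, v) \<in> acc M} = U"
    and "u \<in> reachable M w"
  shows "holds M u (inst M \<sigma> \<psi>) \<longleftrightarrow> sat U (L u) \<psi>"
  using assms(5)
proof (induction \<psi> arbitrary: u)
  case (Box \<psi>)
  have IH: "holds M v (inst M \<sigma> \<psi>) \<longleftrightarrow> sat U (L v) \<psi>" if "(u, v) \<in> acc M" for v
    using Box that by (auto simp: reachable_def intro: rtrancl_into_rtrancl)
  have "holds M u (inst M \<sigma> (Box \<psi>)) \<longleftrightarrow> (\<forall>v. (u, v) \<in> acc M \<longrightarrow> holds M v (inst M \<sigma> \<psi>))"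
    using M reachable_in_worlds[OF M w Box.prems] by (simp add: kripke_model_def)
  also have "\<dots> \<longleftrightarrow> (\<forall>x \<in> L ` {v. (u, v) \<in> acc M}. sat U x \<psi>)"
    using IH by auto
  finally show ?case
    by (simp add: L[OF Box.prems])
qed (use M \<sigma> reachable_in_worlds[OF M w] in \<open>auto simp: kripke_model_def\<close>)

theorem theorem3:
  fixes M :: "('w, 's) kripke" and w :: 'w and C :: "'s set" and \<phi> :: "nat mfm"
  assumes "kripke_model M"
    and "w \<in> worlds M"
    and "boolean_closed M C"
    and "arbitrarily_large_independent_switches M w C"
    and "valid_at M w C \<phi>"
  shows "\<phi> \<in> S5"
proof (rule ccontr)
  assume "\<phi> \<notin> S5"
  then obtain U v where U: "U \<subseteq> Pow (vars \<phi>)" "v \<in> U" "\<not> sat U v \<phi>"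
    by (rule S5_complete)
  have "finite (vars \<phi>)"
    by (induction \<phi>) auto
  then have "finite U"
    using U(1) finite_subset by blast
  \<comment> \<open>The successor makes \<open>I\<close>, and hence \<open>C\<close>, nonempty even
    without an appeal to \<open>v \<in> U\<close>; the \<open>2 ^ card I\<close> patterns are then
    enough to cover \<open>U\<close>.\<close>
  obtain I :: "nat set" and s where I: "finite I" "Suc (card U) \<le> card I" "s ` I \<subseteq> C"
    and indep: "independent_switches M w I s"
    using assms(4)[unfolded arbitrarily_large_independent_switches_def, rule_format, of "Suc (card U)"]
    by (elim exE conjE)
  have indep_patterns:
      "\<forall>p. \<exists>x. (u, x) \<in> acc M \<and> (\<forall>i\<in>I. holds M x (s i) \<longleftrightarrow> p i)" if "u \<in> reachable M w" for u
    using indep that I(1) unfolding independent_switches_def by simp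
  have "C \<noteq> {}"
    using I by auto
  define pat where "pat u = {i \<in> I. holds M u (s i)}" for u
  have "card U \<le> card (Pow I)"
    using I(2) less_exp[of "card I"] unfolding card_Pow[OF I(1)] by linarith
  then obtain f where f: "f ` Pow I = U" "f (pat w) = v"
    using surjection_with_prescribed_value[of "Pow I" U "pat w" v] I(1) \<open>finite U\<close> U(2)
    by (auto simp: pat_def)
  have "\<exists>a\<in>C. \<forall>u\<in>worlds M. holds M u a \<longleftrightarrow> i \<in> f (pat u)" for i
    using boolean_combination_exists[OF assms(1,3) \<open>C \<noteq> {}\<close> I(1,3), of "\<lambda>P. i \<in> f P"]
    by (simp add: pat_def)
  then obtain \<sigma> where \<sigma>: "\<And>i. \<sigma> i \<in> C"
      "\<And>u i. u \<in> worlds M \<Longrightarrow> holds M u (\<sigma> i) \<longleftrightarrow> i \<in> f (pat u)"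
    by metis
  have "(\<lambda>u. f (pat u)) ` {x. (u, x) \<in> acc M} = U" if "u \<in> reachable M w" for u
  proof -
    \<comment> \<open>Independence, applied to all of \<open>I\<close> at once, realizes each
      pattern at a single successor of \<open>u\<close>.\<close>
    have "P \<in> pat ` {x. (u, x) \<in> acc M}" if "P \<subseteq> I" for P
    proof -
      obtain x where "(u, x) \<in> acc M" "\<forall>i\<in>I. holds M x (s i) \<longleftrightarrow> i \<in> P"
        using spec[OF indep_patterns[OF \<open>u \<in> reachable M w\<close>], of "\<lambda>i. i \<in> P"] by (elim exE conjE)
      moreover from this have "pat x = P"
        using that by (auto simp: pat_def)
      ultimately show ?thesis by auto
    qed
    then have "pat ` {x. (u, x) \<in> acc M} = Pow I"
      by (auto simp: pat_def)
    then show ?thesis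
      using f(1) by (metis image_image)
  qed
  moreover have "w \<in> reachable M w"
    by (simp add: reachable_def)
  ultimately have "holds M w (inst M \<sigma> \<phi>) \<longleftrightarrow> sat U (f (pat w)) \<phi>"
    using holds_inst_iff_sat_label[OF assms(1,2), of \<sigma> "\<lambda>u. f (pat u)" U w \<phi>] \<sigma>(2) by blast
  moreover have "holds M w (inst M \<sigma> \<phi>)"
    using assms(5) \<sigma>(1) unfolding valid_at_def by blast
  ultimately show False
    using f(2) U(3) by simp
qed

end
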